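(* Let $P_1,\dots,P_n$ be discrete probability measures. Then the greedy construction algorithm (described in the context), which constructs a vector $\mathbf{w}$ with $A\mathbf{w}=d$, runs in $\mathcal{O}\!\left(n\sum_{i=1}^n|P_i|\right)$ in the arithmetic model of computation.
   Context: Measures: each $P_i$ is a probability measure on $\mathbb{R}^d$ with finite support; $|P_i|$ denotes the size of its support. Its support points $x_{i1},\dots,x_{i|P_i|}$ have masses $d_{ij}>0$ with $\sum_j d_{ij}=1$. The system $A\mathbf{w}=d$ (here $d$ denotes the right-hand side vector, not the dimension): the columns of $A$ are indexed by the combinations $(x_{1j_1},\dots,x_{nj_n})$, $1\le j_i\le|P_i|$. With $n_o(i)=\prod_{l=i+1}^n|P_l|$ (so $n_o(n)=1$), the combination has column index $h=\sum_{i=1}^n(j_i-1)\,n_o(i)\in\{0,\dots,\prod_{i=1}^n|P_i|-1\}$. $A$ has one row for each pair $(i,j)$, $1\le i\le n$, $1\le j\le|P_i|$; the entry in row $(i,j)$ and the column of $(x_{1j_1},\dots,x_{nj_n})$ is $1$ if $j_i=j$ and $0$ otherwise. The right-hand side $d$ has entry $d_{ij}$ in row $(i,j)$. Greedy construction algorithm. Input: the vector $n_o=(n_o(1),\dots,n_o(n))$, together with the measures. Output: the vector $\mathbf{w}$. Initialize remaining masses $r_{ij}=d_{ij}$ for all $i=1,\dots,n$ and $j=1,\dots,|P_i|$; let $L=1$, $m_1=0$, $\mathbf{w}=\mathbf{0}$, and $j_i=1$ for all $i=1,\dots,n$. While $\sum_{l=1}^L m_l<1$ (where $m_L$ counts as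 $0$ as long as it has not yet been assigned a value): (1) set $m_L=\min_{1\le i\le n} r_{ij_i}$; (2) set $h=\sum_{i=1}^n(j_i-1)n_o(i)$; (3) set $w_h=m_L$; (4) for $i=1,\dots,n$: replace $r_{ij_i}$ by $r_{ij_i}-m_L$, and if now $r_{ij_i}=0$, replace $j_i$ by $j_i+1$; (5) replace $L$ by $L+1$. In the arithmetic model of computation, each elementary arithmetic operation or comparison on real numbers costs one unit. *)

theory Defs
  imports "HOL-Probability.Probability_Mass_Function" "HOL-Library.While_Combinator"
begin

section \<open>The linear system\<close>

text \<open>
  All indices \<open>i\<close>, \<open>j\<close> are 1-based. \<open>N i\<close> is the support size of the \<open>i\<close>-th measure, and a
  combination of support points is given by its tuple of indices \<open>js\<close>.
\<close>

definition combinations :: "nat \<Rightarrow> (nat \<Rightarrow> nat) \<Rightarrow> (nat \<Rightarrow> nat) set" where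
  "combinations n N = (\<Pi>\<^sub>E i\<in>{1..n}. {1..N i})"

definition offset :: "nat \<Rightarrow> (nat \<Rightarrow> nat) \<Rightarrow> nat \<Rightarrow> nat" where
  "offset n N i = (\<Prod>l=i+1..n. N l)"

definition column_index :: "nat \<Rightarrow> (nat \<Rightarrow> nat) \<Rightarrow> (nat \<Rightarrow> nat) \<Rightarrow> nat" where
  "column_index n N js = (\<Sum>i=1..n. (js i - 1) * offset n N i)"

definition constraint_matrix :: "nat \<Rightarrow> (nat \<Rightarrow> nat) \<Rightarrow> nat \<times> nat \<Rightarrow> nat \<Rightarrow> real" where
  "constraint_matrix n N = (\<lambda>(i, j) h.
     if \<exists>js\<in>combinations n N. column_index n N js = h \<and> js i = j then 1 else 0)"

definition solves_system ::
    "nat \<Rightarrow> (nat \<Rightarrow> nat) \<Rightarrow> (nat \<Rightarrow> nat \<Rightarrow> real) \<Rightarrow> (nat \<Rightarrow> real) \<Rightarrow> bool" where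
  "solves_system n N d w \<longleftrightarrow> (\<forall>i\<in>{1..n}. \<forall>j\<in>{1..N i}.
     (\<Sum>h<(\<Prod>l=1..n. N l). constraint_matrix n N (i, j) h * w h) = d i j)"


section \<open>Counting operations\<close>

text \<open>
  A computation returns its result together with the number of elementary arithmetic operations
  and comparisons performed. Integer operations of the program (such as those in the computation
  of a column index) are charged like operations on reals. Copying values, reading and writing
  array cells and sequencing are free.
\<close>

type_synonym 'a timed = "'a \<times> nat"

definition return_timed :: "'a \<Rightarrow> 'a timed" where
  "return_timed a = (a, 0)"

definition bind_timed :: "'a timed \<Rightarrow> ('a \<Rightarrow> 'b timed) \<Rightarrow> 'b timed" where
  "bind_timed p f = (case p of (a, t) \<Rightarrow> case f a of (b, u) \<Rightarrow> (b, t + u))"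

adhoc_overloading Monad_Syntax.bind \<rightleftharpoons> bind_timed

definition add_op :: "'a::plus \<Rightarrow> 'a \<Rightarrow> 'a timed" where
  "add_op a b = (a + b, 1)"

definition sub_op :: "'a::minus \<Rightarrow> 'a \<Rightarrow> 'a timed" where
  "sub_op a b = (a - b, 1)"

definition mult_op :: "'a::times \<Rightarrow> 'a \<Rightarrow> 'a timed" where
  "mult_op a b = (a * b, 1)"

definition less_op :: "'a::ord \<Rightarrow> 'a \<Rightarrow> bool timed" where
  "less_op a b = (a < b, 1)"

definition eq_op :: "'a \<Rightarrow> 'a \<Rightarrow> bool timed" where
  "eq_op a b = (a = b, 1)"

fun for_timed :: "'b list \<Rightarrow> ('b \<Rightarrow> 's \<Rightarrow> 's timed) \<Rightarrow> 's \<Rightarrow> 's timed" where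
  "for_timed [] f s = return_timed s"
| "for_timed (x # xs) f s = do { s' \<leftarrow> f x s; for_timed xs f s' }"

text \<open>
  The result is \<open>None\<close> iff the loop does not terminate. Every evaluation of the guard is charged,
  including the final, failing one.
\<close>

definition while_timed :: "('s \<Rightarrow> bool timed) \<Rightarrow> ('s \<Rightarrow> 's timed) \<Rightarrow> 's \<Rightarrow> 's timed option" where
  "while_timed b c s =
     map_option (\<lambda>(s, t). (s, t + snd (b s)))
       (while_option
          (\<lambda>(s, t). fst (b s))
          (\<lambda>(s, t). case c s of (s', u) \<Rightarrow> (s', t + snd (b s) + u))
          (s, 0))"


section \<open>The greedy construction\<close>

text \<open>
  The field \<open>total\<close> holds the value of the sum in the loop guard. It is maintained incrementally,
  since recomputing the sum in every pass would take quadratic time in the number of passes; see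
  \<open>greedy_step_total\<close> below.
\<close>

record greedy_state =
  rem :: "nat \<Rightarrow> nat \<Rightarrow> real"
  pos :: "nat \<Rightarrow> nat"
  step :: nat
  mass :: "nat \<Rightarrow> real"
  total :: real
  weight :: "nat \<Rightarrow> real"

definition min_remaining :: "nat \<Rightarrow> (nat \<Rightarrow> nat \<Rightarrow> real) \<Rightarrow> (nat \<Rightarrow> nat) \<Rightarrow> real timed" where
  "min_remaining n r j =
     for_timed [2..<n+1]
       (\<lambda>i a. do { c \<leftarrow> less_op (r i (j i)) a; return_timed (if c then r i (j i) else a) })
       (r 1 (j 1))"

definition compute_index :: "nat \<Rightarrow> (nat \<Rightarrow> nat) \<Rightarrow> (nat \<Rightarrow> nat) \<Rightarrow> nat timed" where
  "compute_index n no j =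
     for_timed [1..<n+1]
       (\<lambda>i h. do { a \<leftarrow> sub_op (j i) 1; b \<leftarrow> mult_op a (no i); add_op h b })
       0"

definition subtract_mass ::
    "nat \<Rightarrow> real \<Rightarrow> (nat \<Rightarrow> nat \<Rightarrow> real) \<times> (nat \<Rightarrow> nat)
      \<Rightarrow> ((nat \<Rightarrow> nat \<Rightarrow> real) \<times> (nat \<Rightarrow> nat)) timed" where
  "subtract_mass n m =
     for_timed [1..<n+1]
       (\<lambda>i (r, j). do {
          v \<leftarrow> sub_op (r i (j i)) m;
          z \<leftarrow> eq_op v 0;
          k \<leftarrow> (if z then add_op (j i) 1 else return_timed (j i));
          return_timed (r(i := (r i)(j i := v)), j(i := k)) })"

definition greedy_init :: "(nat \<Rightarrow> nat \<Rightarrow> real) \<Rightarrow> greedy_state" where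
  "greedy_init d =
     \<lparr>rem = d, pos = (\<lambda>_. 1), step = 1, mass = (\<lambda>_. 0), total = 0, weight = (\<lambda>_. 0)\<rparr>"

definition greedy_guard :: "greedy_state \<Rightarrow> bool timed" where
  "greedy_guard st = less_op (total st) 1"

definition greedy_step :: "nat \<Rightarrow> (nat \<Rightarrow> nat) \<Rightarrow> greedy_state \<Rightarrow> greedy_state timed" where
  "greedy_step n no st = do {
     m \<leftarrow> min_remaining n (rem st) (pos st);
     s \<leftarrow> add_op (total st) m;
     h \<leftarrow> compute_index n no (pos st);
     (r, j) \<leftarrow> subtract_mass n m (rem st, pos st);
     l \<leftarrow> add_op (step st) 1;
     return_timed
       \<lparr>rem = r, pos = j, step = l, mass = (mass st)(step st := m), total = s,
        weight = (weight st)(h := m)\<rparr> }"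

definition greedy ::
    "nat \<Rightarrow> (nat \<Rightarrow> nat) \<Rightarrow> (nat \<Rightarrow> nat \<Rightarrow> real) \<Rightarrow> (nat \<Rightarrow> real) timed option" where
  "greedy n no d =
     map_option (\<lambda>(st, t). (weight st, t))
       (while_timed greedy_guard (greedy_step n no) (greedy_init d))"

text \<open>
  Correctness of the incremental sum: the following property holds initially and is preserved, and
  it identifies \<open>total\<close> with the sum over \<open>l = 1..L\<close>, where unassigned masses are 0.
\<close>

definition total_correct :: "greedy_state \<Rightarrow> bool" where
  "total_correct st \<longleftrightarrow> 1 \<le> step st \<and> (\<forall>l\<ge>step st. mass st l = 0) \<and>
     total st = (\<Sum>l=1..step st. mass st l)"

lemma greedy_init_total: "total_correct (greedy_init d)"
  by (simp add: total_correct_def greedy_init_def)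

lemma greedy_step_total:
  assumes "total_correct st"
  shows "total_correct (fst (greedy_step n no st))"
proof -
  obtain k where k: "step st = Suc k"
    using assms by (cases "step st") (auto simp: total_correct_def)
  have "mass st (Suc k) = 0" "mass st (Suc (Suc k)) = 0" "\<And>l. l \<ge> Suc k \<Longrightarrow> mass st l = 0"
    using assms by (auto simp: total_correct_def k)
  moreover have "total st = (\<Sum>l=1..k. mass st l)"
    using assms calculation(1) by (simp add: total_correct_def k)
  moreover have "(\<Sum>l=1..k. if l = Suc k then m else mass st l) = (\<Sum>l=1..k. mass st l)" for m
    by (rule sum.cong) auto
  ultimately show ?thesis
    by (simp add: total_correct_def greedy_step_def bind_timed_def return_timed_def add_op_def k
        split: prod.split)
qed

end

theory Submission
  imports Defs
begin

text \<open>
  Stacking the masses of each measure in the order of the indices \<open>j\<close> subdivides \<open>[0, 1]\<close> into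
  intervals, and the algorithm sweeps through the common refinement of these \<open>n\<close> subdivisions.
  Each pass has positive mass to distribute and exhausts at least one support point, namely one
  that attains the minimum, so the number of points that are not yet exhausted strictly decreases and there are at most \<open>\<Sum>i. N i\<close> passes. A pass consists of three scans of the
  \<open>n\<close> current points and costs at most \<open>9 * n\<close> operations; the last, failing guard costs one more.
  This gives the bound with constant 10.

  For correctness, the loop maintains the identity \<open>A w + r = d\<close>, where \<open>r\<close> is the vector of
  remaining masses (\<open>greedy_invariant_step\<close>). Two points need care. Writing \<open>w\<^sub>h\<close> must not
  overwrite a weight: the tuple of positions strictly increases from pass to pass, and the column
  index is injective on combinations because it is a mixed-radix expansion
  (\<open>column_index_inject\<close>). Moreover, positions must stay within the supports while the guard holds:
  every measure retains mass exactly 1 minus the distributed total, so an unexhausted point is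
  left in each of them as long as that total is below 1. When the total reaches 1 nothing remains,
  and \<open>A w = d\<close>.
\<close>

section \<open>Column indices\<close>

text \<open>
  Horner form of the column index: the last coordinate is the least significant digit.
\<close>

lemma column_index_Suc:
  "column_index (Suc n) N js = column_index n N js * N (Suc n) + (js (Suc n) - 1)"
proof -
  have "offset (Suc n) N i = offset n N i * N (Suc n)" if "i \<in> {1..n}" for i
    using that by (simp add: offset_def)
  then have "(\<Sum>i=1..n. (js i - 1) * offset (Suc n) N i)
      = (\<Sum>i=1..n. (js i - 1) * offset n N i * N (Suc n))"
    by (intro sum.cong) simp_all
  then show ?thesis
    by (simp add: column_index_def sum_distrib_right offset_def)
qed

lemma column_index_cong:
  assumes "\<And>i. i \<in> {1..n} \<Longrightarrow> js i = ks i"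
  shows "column_index n N js = column_index n N ks"
  using assms by (simp add: column_index_def)

lemma column_index_less:
  assumes "\<And>i. i \<in> {1..n} \<Longrightarrow> 1 \<le> js i \<and> js i \<le> N i"
  shows "column_index n N js < (\<Prod>l=1..n. N l)"
  using assms
proof (induction n)
  case 0
  show ?case by (simp add: column_index_def)
next
  case (Suc n)
  have "column_index n N js < (\<Prod>l=1..n. N l)"
    by (rule Suc.IH) (use Suc.prems in auto)
  then have "(column_index n N js + 1) * N (Suc n) \<le> (\<Prod>l=1..n. N l) * N (Suc n)"
    by (intro mult_right_mono) auto
  moreover have "js (Suc n) - 1 < N (Suc n)"
    using Suc.prems[of "Suc n"] by auto
  ultimately show ?case
    by (simp add: column_index_Suc)
qed

lemma column_index_inject:
  assumes "\<And>i. i \<in> {1..n} \<Longrightarrow> 1 \<le> js i \<and> js i \<le> N i"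
    and "\<And>i. i \<in> {1..n} \<Longrightarrow> 1 \<le> ks i \<and> ks i \<le> N i"
    and "column_index n N js = column_index n N ks" and "i \<in> {1..n}"
  shows "js i = ks i"
  using assms
proof (induction n)
  case 0
  then show ?case by simp
next
  case (Suc n)
  let ?b = "N (Suc n)"
  have digits: "js (Suc n) - 1 < ?b" "ks (Suc n) - 1 < ?b"
    using Suc.prems(1,2)[of "Suc n"] by auto
  have eq: "column_index n N js * ?b + (js (Suc n) - 1)
      = column_index n N ks * ?b + (ks (Suc n) - 1)"
    using Suc.prems(3) by (simp add: column_index_Suc)
  have high: "column_index n N js = column_index n N ks"
    using arg_cong[OF eq, of "\<lambda>a. a div ?b"] digits by simp
  have "js (Suc n) - 1 = ks (Suc n) - 1"
    using arg_cong[OF eq, of "\<lambda>a. a mod ?b"] digits by simp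
  moreover have "1 \<le> js (Suc n)" "1 \<le> ks (Suc n)"
    using Suc.prems(1,2)[of "Suc n"] by auto
  ultimately have "js (Suc n) = ks (Suc n)"
    by linarith
  moreover have "js i = ks i" if "i \<in> {1..n}"
    by (rule Suc.IH) (use Suc.prems(1,2) high that in auto)
  ultimately show ?case
    using Suc.prems(4) by (cases "i = Suc n") auto
qed

lemma constraint_matrix_column_index:
  assumes range: "\<And>i. i \<in> {1..n} \<Longrightarrow> 1 \<le> js i \<and> js i \<le> N i" and i: "i \<in> {1..n}"
  shows "constraint_matrix n N (i, k) (column_index n N js) = (if js i = k then 1 else 0)"
proof -
  have "(\<exists>ks\<in>combinations n N. column_index n N ks = column_index n N js \<and> ks i = k)
      \<longleftrightarrow> js i = k"
  proof
    assume "\<exists>ks\<in>combinations n N. column_index n N ks = column_index n N js \<and> ks i = k"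
    then obtain ks where ks: "ks \<in> combinations n N"
      "column_index n N ks = column_index n N js" "ks i = k" by blast
    have "1 \<le> ks l \<and> ks l \<le> N l" if "l \<in> {1..n}" for l
      using ks(1) that by (auto simp: combinations_def PiE_iff)
    then show "js i = k"
      using column_index_inject[OF _ range ks(2) i] ks(3) by auto
  next
    assume k: "js i = k"
    \<comment> \<open>Combinations are extensional functions, while positions are arbitrary outside the index range.\<close>
    let ?ks = "restrict js {1..n}"
    have "?ks \<in> combinations n N"
      using range by (auto simp: combinations_def)
    moreover have "column_index n N ?ks = column_index n N js"
      by (rule column_index_cong) simp
    ultimately show "\<exists>ks\<in>combinations n N. column_index n N ks = column_index n N js \<and> ks i = k"
      using k i by (intro bexI[of _ ?ks]) auto
  qed
  then show ?thesis
    by (simp add: constraint_matrix_def)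
qed


section \<open>Results and costs of the loops\<close>

text \<open>
  A loop whose invariant carries a strictly decreasing natural-number potential \<open>\<phi>\<close> terminates, and
  its cost is at most the cost of one pass times the initial potential, plus one failing guard.
\<close>

lemma while_timed_potential:
  fixes \<phi> :: "'s \<Rightarrow> nat"
  assumes init: "P s"
    and pass: "\<And>s. P s \<Longrightarrow> fst (b s) \<Longrightarrow>
      P (fst (c s)) \<and> \<phi> (fst (c s)) < \<phi> s \<and> snd (b s) + snd (c s) \<le> K"
    and final: "\<And>s. P s \<Longrightarrow> \<not> fst (b s) \<Longrightarrow> snd (b s) \<le> K'"
  shows "\<exists>s' t. while_timed b c s = Some (s', t) \<and> P s' \<and> \<not> fst (b s') \<and> t \<le> K * \<phi> s + K'"
proof -
  define guard where "guard = (\<lambda>(s, t::nat). fst (b s))"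
  define body where "body = (\<lambda>(s, t). case c s of (s', u) \<Rightarrow> (s', t + snd (b s) + u))"
  define Q where "Q = (\<lambda>(s', t). P s' \<and> t + K * \<phi> s' \<le> K * \<phi> s)"
  have step: "Q (body st) \<and> \<phi> (fst (body st)) < \<phi> (fst st)" if "Q st" "guard st" for st
  proof -
    obtain s1 t1 where st: "st = (s1, t1)" by (cases st)
    have P: "P s1" and t: "t1 + K * \<phi> s1 \<le> K * \<phi> s" and g: "fst (b s1)"
      using that by (auto simp: st Q_def guard_def)
    note p = pass[OF P g]
    have "K * (\<phi> (fst (c s1)) + 1) \<le> K * \<phi> s1"
      using p by (intro mult_left_mono) auto
    then show ?thesis
      using p t by (auto simp: st Q_def body_def split: prod.split)
  qed
  have Q0: "Q (s, 0)" using init by (simp add: Q_def)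
  obtain st where st: "while_option guard body (s, 0) = Some st"
    using measure_while_option_Some[of Q guard body "\<phi> \<circ> fst", OF _ Q0] step by auto
  have "Q st"
    using while_option_rule[of Q guard body, OF _ st Q0] step by blast
  moreover have "\<not> guard st"
    using while_option_stop[OF st] .
  ultimately have "P (fst st)" "\<not> fst (b (fst st))" "snd st + K * \<phi> (fst st) \<le> K * \<phi> s"
    by (auto simp: Q_def guard_def)
  moreover have "while_timed b c s = Some (fst st, snd st + snd (b (fst st)))"
    using st unfolding while_timed_def guard_def body_def by (simp add: split_beta)
  ultimately show ?thesis
    using final[of "fst st"] by fastforce
qed

lemma for_min:
  fixes f :: "'b \<Rightarrow> real"
  defines "body \<equiv> \<lambda>i a. do { c \<leftarrow> less_op (f i) a; return_timed (if c then f i else a) }"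
  shows "snd (for_timed xs body a) = length xs \<and>
    fst (for_timed xs body a) \<in> insert a (f ` set xs) \<and>
    (\<forall>y\<in>insert a (f ` set xs). fst (for_timed xs body a) \<le> y)"
proof (induction xs arbitrary: a)
  case Nil
  show ?case by (simp add: return_timed_def)
next
  case (Cons z xs)
  define a' where "a' = (if f z < a then f z else a)"
  have "body z a = (a', 1)"
    by (simp add: body_def less_op_def bind_timed_def return_timed_def a'_def)
  then have unfold: "for_timed (z # xs) body a
      = (fst (for_timed xs body a'), 1 + snd (for_timed xs body a'))"
    by (simp add: bind_timed_def split_beta)
  have "a' \<le> a" "a' \<le> f z" "a' \<in> {a, f z}"
    by (auto simp: a'_def)
  then show ?case
    using Cons.IH[of a'] unfolding unfold by auto
qed

lemma min_remaining:
  assumes "1 \<le> n"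
  shows "\<exists>i\<in>{1..n}. fst (min_remaining n r j) = r i (j i)"
    and "\<And>i. i \<in> {1..n} \<Longrightarrow> fst (min_remaining n r j) \<le> r i (j i)"
    and "snd (min_remaining n r j) = n - 1"
proof -
  have "insert (r 1 (j 1)) ((\<lambda>i. r i (j i)) ` set [2..<n+1]) = (\<lambda>i. r i (j i)) ` insert 1 {2..n}"
    by auto
  also have "insert 1 {2..n} = {1..n}"
    using assms by auto
  finally have img: "insert (r 1 (j 1)) ((\<lambda>i. r i (j i)) ` set [2..<n+1])
      = (\<lambda>i. r i (j i)) ` {1..n}" .
  have len: "length [2..<n+1] = n - 1" using assms by (simp del: upt_Suc)
  have *: "snd (min_remaining n r j) = n - 1 \<and>
      fst (min_remaining n r j) \<in> (\<lambda>i. r i (j i)) ` {1..n} \<and>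
      (\<forall>y\<in>(\<lambda>i. r i (j i)) ` {1..n}. fst (min_remaining n r j) \<le> y)"
    using for_min[of "[2..<n+1]" "\<lambda>i. r i (j i)" "r 1 (j 1)"]
    unfolding min_remaining_def img len .
  show "\<exists>i\<in>{1..n}. fst (min_remaining n r j) = r i (j i)"
    and "\<And>i. i \<in> {1..n} \<Longrightarrow> fst (min_remaining n r j) \<le> r i (j i)"
    and "snd (min_remaining n r j) = n - 1"
    using * by blast+
qed

lemma compute_index: "compute_index n (offset n N) j = (column_index n N j, 3 * n)"
proof -
  have "for_timed xs (\<lambda>i h. do { a \<leftarrow> sub_op (j i) 1; b \<leftarrow> mult_op a (no i); add_op h b }) h
      = (h + sum_list (map (\<lambda>i. (j i - 1) * no i) xs), 3 * length xs)" for xs no h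
    by (induction xs arbitrary: h)
      (simp_all add: bind_timed_def return_timed_def sub_op_def mult_op_def add_op_def)
  moreover have "sum_list (map f [1..<n+1]) = (\<Sum>i=1..n. f i)" for f :: "nat \<Rightarrow> nat"
    by (simp add: interv_sum_list_conv_sum_set_nat atLeastLessThanSuc_atLeastAtMost del: upt_Suc)
  ultimately show ?thesis
    by (simp add: compute_index_def column_index_def del: upt_Suc)
qed

text \<open>
  The sequential updates act on distinct rows, so they amount to one simultaneous update.
\<close>

lemma for_subtract:
  fixes m :: real and r :: "nat \<Rightarrow> nat \<Rightarrow> real"
  assumes "distinct xs"
  defines "body \<equiv> \<lambda>i (r, j). do {
          v \<leftarrow> sub_op (r i (j i)) m;
          z \<leftarrow> eq_op v 0;
          k \<leftarrow> (if z then add_op (j i) 1 else return_timed (j i));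
          return_timed (r(i := (r i)(j i := v)), j(i := k)) }"
  shows "fst (for_timed xs body (r, j)) =
      ((\<lambda>i. if i \<in> set xs then (r i)(j i := r i (j i) - m) else r i),
       (\<lambda>i. if i \<in> set xs \<and> r i (j i) = m then j i + 1 else j i)) \<and>
    snd (for_timed xs body (r, j)) \<le> 3 * length xs"
  using assms(1)
proof (induction xs arbitrary: r j)
  case Nil
  show ?case by (simp add: return_timed_def)
next
  case (Cons z xs)
  define r' where "r' = r(z := (r z)(j z := r z (j z) - m))"
  define j' where "j' = j(z := if r z (j z) = m then j z + 1 else j z)"
  define u where "u = snd (body z (r, j))"
  have body: "body z (r, j) = ((r', j'), u)" and u: "u \<le> 3"
    by (auto simp: body_def bind_timed_def return_timed_def sub_op_def add_op_def eq_op_def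
        r'_def j'_def u_def split_beta)
  have unfold: "for_timed (z # xs) body (r, j)
      = (fst (for_timed xs body (r', j')), u + snd (for_timed xs body (r', j')))"
    by (simp add: body bind_timed_def split_beta)
  have "z \<notin> set xs" using Cons.prems by simp
  moreover have "fst (for_timed xs body (r', j')) =
      ((\<lambda>i. if i \<in> set xs then (r' i)(j' i := r' i (j' i) - m) else r' i),
       (\<lambda>i. if i \<in> set xs \<and> r' i (j' i) = m then j' i + 1 else j' i))"
    and "snd (for_timed xs body (r', j')) \<le> 3 * length xs"
    using Cons.IH[of r' j'] Cons.prems by auto
  ultimately show ?case
    unfolding unfold using u by (auto simp: r'_def j'_def fun_eq_iff)
qed

lemma subtract_mass:
  "fst (subtract_mass n m (r, j)) =
      ((\<lambda>i. if i \<in> {1..n} then (r i)(j i := r i (j i) - m) else r i),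
       (\<lambda>i. if i \<in> {1..n} \<and> r i (j i) = m then j i + 1 else j i))"
  "snd (subtract_mass n m (r, j)) \<le> 3 * n"
proof -
  have list: "distinct [1..<n+1]" "set [1..<n+1] = {1..n}" "length [1..<n+1] = n" by auto
  show "fst (subtract_mass n m (r, j)) =
      ((\<lambda>i. if i \<in> {1..n} then (r i)(j i := r i (j i) - m) else r i),
       (\<lambda>i. if i \<in> {1..n} \<and> r i (j i) = m then j i + 1 else j i))"
    "snd (subtract_mass n m (r, j)) \<le> 3 * n"
    using for_subtract[of "[1..<n+1]" m r j, OF list(1)]
    unfolding subtract_mass_def list by blast+
qed

lemma greedy_step_eq:
  assumes "m = fst (min_remaining n (rem st) (pos st))"
  shows "rem (fst (greedy_step n (offset n N) st)) = (\<lambda>i. if i \<in> {1..n}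
      then (rem st i)(pos st i := rem st i (pos st i) - m) else rem st i)"
    and "pos (fst (greedy_step n (offset n N) st)) =
      (\<lambda>i. if i \<in> {1..n} \<and> rem st i (pos st i) = m then pos st i + 1 else pos st i)"
    and "total (fst (greedy_step n (offset n N) st)) = total st + m"
    and "weight (fst (greedy_step n (offset n N) st)) =
      (weight st)(column_index n N (pos st) := m)"
  using subtract_mass(1)[of n m "rem st" "pos st"]
  by (simp_all only: greedy_step_def assms bind_timed_def add_op_def compute_index
      return_timed_def split_beta prod.sel greedy_state.simps)

text \<open>
  The exact bound is \<open>7 * n + 2\<close>: at most \<open>3 * n\<close> operations each for the column index and the
  subtraction, \<open>n - 1\<close> for the minimum, two single additions, and the guard.
\<close>

lemma greedy_step_cost:
  assumes "1 \<le> n"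
  shows "snd (greedy_guard st) + snd (greedy_step n (offset n N) st) \<le> 9 * n"
proof -
  define m where "m = fst (min_remaining n (rem st) (pos st))"
  have "snd (greedy_step n (offset n N) st)
      = (n - 1) + 1 + 3 * n + snd (subtract_mass n m (rem st, pos st)) + 1"
    using min_remaining(3)[OF assms, of "rem st" "pos st"]
    by (simp add: greedy_step_def m_def bind_timed_def add_op_def compute_index return_timed_def
        split_beta)
  then show ?thesis
    using subtract_mass(2)[of n m "rem st" "pos st"] assms
    by (simp add: greedy_guard_def less_op_def)
qed


section \<open>The loop invariant\<close>

text \<open>
  In each measure exactly the points before the current position are exhausted, and the remaining
  mass complements the distributed total; a position may be one past the end. The weights together
  with the remaining masses solve the system, and every column already used belongs to a combination
  having some coordinate strictly behind the current position.
\<close>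

definition greedy_invariant ::
    "nat \<Rightarrow> (nat \<Rightarrow> nat) \<Rightarrow> (nat \<Rightarrow> nat \<Rightarrow> real) \<Rightarrow> greedy_state \<Rightarrow> bool" where
  "greedy_invariant n N d st \<longleftrightarrow>
     (\<forall>i\<in>{1..n}. 1 \<le> pos st i \<and> pos st i \<le> N i + 1 \<and>
        (\<forall>k\<in>{1..N i}. if k < pos st i then rem st i k = 0 else 0 < rem st i k) \<and>
        (\<Sum>k=1..N i. rem st i k) = 1 - total st) \<and>
     (\<forall>i\<in>{1..n}. \<forall>k\<in>{1..N i}.
        (\<Sum>h<(\<Prod>l=1..n. N l). constraint_matrix n N (i, k) h * weight st h)
          = d i k - rem st i k) \<and>
     (\<forall>h. weight st h \<noteq> 0 \<longrightarrow> (\<exists>js. (\<forall>i\<in>{1..n}. 1 \<le> js i \<and> js i \<le> N i) \<and>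
        column_index n N js = h \<and> (\<exists>i\<in>{1..n}. js i < pos st i)))"

text \<open>The number of support points that are not yet exhausted.\<close>

definition unexhausted :: "nat \<Rightarrow> (nat \<Rightarrow> nat) \<Rightarrow> greedy_state \<Rightarrow> nat" where
  "unexhausted n N st = (\<Sum>i=1..n. N i + 1 - pos st i)"

lemma greedy_invariant_init:
  assumes "\<And>i k. i \<in> {1..n} \<Longrightarrow> k \<in> {1..N i} \<Longrightarrow> 0 < d i k"
    and "\<And>i. i \<in> {1..n} \<Longrightarrow> (\<Sum>k=1..N i. d i k) = 1"
  shows "greedy_invariant n N d (greedy_init d)"
  using assms by (auto simp: greedy_invariant_def greedy_init_def)

lemma greedy_invariant_step:
  assumes n: "1 \<le> n" and inv: "greedy_invariant n N d st" and guard: "total st < 1"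
  defines "st' \<equiv> fst (greedy_step n (offset n N) st)"
  shows "greedy_invariant n N d st' \<and> unexhausted n N st' < unexhausted n N st"
proof -
  define m where "m = fst (min_remaining n (rem st) (pos st))"
  define h0 where "h0 = column_index n N (pos st)"
  let ?r = "rem st" and ?j = "pos st" and ?w = "weight st" and ?H = "\<Prod>l=1..n. N l"
  note st' = greedy_step_eq[OF m_def, of N, folded st'_def h0_def]
  have low: "1 \<le> ?j i" and up: "?j i \<le> N i + 1" and sum_r: "(\<Sum>k=1..N i. ?r i k) = 1 - total st"
    if "i \<in> {1..n}" for i
    using inv that by (auto simp: greedy_invariant_def)
  have zero: "?r i k = 0" if "i \<in> {1..n}" "k \<in> {1..N i}" "k < ?j i" for i k
    using inv that by (auto simp: greedy_invariant_def split: if_splits)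
  have pos_r: "0 < ?r i k" if "i \<in> {1..n}" "k \<in> {1..N i}" "?j i \<le> k" for i k
    using inv that by (force simp: greedy_invariant_def split: if_splits)
  have sys: "(\<Sum>h<?H. constraint_matrix n N (i, k) h * ?w h) = d i k - ?r i k"
    if "i \<in> {1..n}" "k \<in> {1..N i}" for i k
    using inv that by (auto simp: greedy_invariant_def)
  have used: "\<exists>js. (\<forall>i\<in>{1..n}. 1 \<le> js i \<and> js i \<le> N i) \<and> column_index n N js = h \<and>
      (\<exists>i\<in>{1..n}. js i < ?j i)" if "?w h \<noteq> 0" for h
    using inv that by (auto simp: greedy_invariant_def)

  \<comment> \<open>A position past the end would leave no mass, although the total is below 1.\<close>
  have range: "1 \<le> ?j i \<and> ?j i \<le> N i" if i: "i \<in> {1..n}" for i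
  proof (rule ccontr)
    assume "\<not> ?thesis"
    then have "?j i = N i + 1" using low[OF i] up[OF i] by auto
    then have "(\<Sum>k=1..N i. ?r i k) = 0"
      using zero[OF i] by (intro sum.neutral) auto
    then show False using sum_r[OF i] guard by simp
  qed
  obtain i0 where i0: "i0 \<in> {1..n}" and m_i0: "m = ?r i0 (?j i0)"
    using min_remaining(1)[OF n, of ?r ?j] by (auto simp: m_def)
  have m_le: "m \<le> ?r i (?j i)" if "i \<in> {1..n}" for i
    using min_remaining(2)[OF n that] by (simp add: m_def)
  have m_pos: "0 < m"
    unfolding m_i0 using range[OF i0] by (intro pos_r[OF i0]) auto
  have mono: "?j i \<le> pos st' i" for i by (simp add: st')
  have adv: "?j i0 < pos st' i0" using i0 m_i0 by (simp add: st')

  \<comment> \<open>By injectivity of the column index, a used column would have all coordinates at the position.\<close>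
  have fresh: "?w h0 = 0"
  proof (rule ccontr)
    assume "?w h0 \<noteq> 0"
    then obtain js i where js: "\<And>i. i \<in> {1..n} \<Longrightarrow> 1 \<le> js i \<and> js i \<le> N i"
      "column_index n N js = h0" and i: "i \<in> {1..n}" "js i < ?j i"
      using used by meson
    from column_index_inject[OF js(1) range js(2)[unfolded h0_def] i(1)] i(2)
    show False by simp
  qed
  have h0_less: "h0 < ?H"
    unfolding h0_def using range by (rule column_index_less)

  have "unexhausted n N st' < unexhausted n N st"
    unfolding unexhausted_def
  proof (rule sum_strict_mono_ex1)
    show "\<forall>i\<in>{1..n}. N i + 1 - pos st' i \<le> N i + 1 - ?j i"
      using mono by (auto intro: diff_le_mono2)
    show "\<exists>i\<in>{1..n}. N i + 1 - pos st' i < N i + 1 - ?j i"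
      using range[OF i0] adv i0 by (intro bexI[of _ i0]) auto
  qed simp

  moreover have "1 \<le> pos st' i" "pos st' i \<le> N i + 1" if "i \<in> {1..n}" for i
    using range[OF that] by (auto simp: st')
  moreover have "if k < pos st' i then rem st' i k = 0 else 0 < rem st' i k"
    if i: "i \<in> {1..n}" and k: "k \<in> {1..N i}" for i k
    using zero[OF i k] pos_r[OF i k] m_le[OF i] i
    by (cases k "?j i" rule: linorder_cases) (auto simp: st')
  moreover have "(\<Sum>k=1..N i. rem st' i k) = 1 - total st'" if i: "i \<in> {1..n}" for i
  proof -
    have "(\<Sum>k=1..N i. rem st' i k) = (\<Sum>k=1..N i. ?r i k - (if k = ?j i then m else 0))"
      using i by (intro sum.cong) (auto simp: st')
    also have "\<dots> = 1 - total st - m"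
      using range[OF i] sum_r[OF i] by (simp add: sum_subtractf)
    finally show ?thesis by (simp add: st')
  qed
  moreover have "(\<Sum>h<?H. constraint_matrix n N (i, k) h * weight st' h) = d i k - rem st' i k"
    if i: "i \<in> {1..n}" and k: "k \<in> {1..N i}" for i k
  proof -
    let ?A = "constraint_matrix n N (i, k)"
    have "(\<Sum>h<?H. ?A h * weight st' h)
        = (\<Sum>h<?H. ?A h * ?w h + (if h = h0 then ?A h0 * m else 0))"
      using fresh by (intro sum.cong) (auto simp: st')
    also have "\<dots> = d i k - ?r i k + ?A h0 * m"
      using h0_less sys[OF i k] by (simp add: sum.distrib)
    also have "?A h0 = (if ?j i = k then 1 else 0)"
      unfolding h0_def using range i by (rule constraint_matrix_column_index)
    finally show ?thesis using i by (auto simp: st')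
  qed
  moreover have "\<exists>js. (\<forall>i\<in>{1..n}. 1 \<le> js i \<and> js i \<le> N i) \<and> column_index n N js = h \<and>
      (\<exists>i\<in>{1..n}. js i < pos st' i)" if "weight st' h \<noteq> 0" for h
  proof (cases "h = h0")
    case True
    then show ?thesis using range adv i0 unfolding h0_def by blast
  next
    case False
    then have "?w h \<noteq> 0" using that by (simp add: st')
    from used[OF this] obtain js i where "\<forall>i\<in>{1..n}. 1 \<le> js i \<and> js i \<le> N i"
      "column_index n N js = h" "i \<in> {1..n}" "js i < ?j i" by blast
    with mono[of i] show ?thesis by (intro exI[of _ js]) (auto intro: less_le_trans)
  qed
  ultimately show ?thesis
    unfolding greedy_invariant_def by blast
qed

lemma greedy_invariant_final:
  assumes inv: "greedy_invariant n N d st" and exit: "1 \<le> total st"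
  shows "solves_system n N d (weight st)"
proof -
  have "rem st i k = 0" if i: "i \<in> {1..n}" and k: "k \<in> {1..N i}" for i k
  proof -
    have "if l < pos st i then rem st i l = 0 else 0 < rem st i l" if "l \<in> {1..N i}" for l
      using inv i that unfolding greedy_invariant_def by blast
    then have nonneg: "0 \<le> rem st i l" if "l \<in> {1..N i}" for l
      using that by (metis less_imp_le order_refl)
    have "(\<Sum>l=1..N i. rem st i l) = 1 - total st"
      using inv i unfolding greedy_invariant_def by blast
    then have "(\<Sum>l=1..N i. rem st i l) \<le> 0"
      using exit by simp
    moreover have "0 \<le> (\<Sum>l=1..N i. rem st i l)"
      using nonneg by (rule sum_nonneg)
    ultimately have "(\<Sum>l=1..N i. rem st i l) = 0"
      by (rule order_antisym)
    then show ?thesis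
      using sum_nonneg_eq_0_iff[of "{1..N i}" "rem st i"] nonneg k by blast
  qed
  then show ?thesis
    using inv by (simp add: greedy_invariant_def solves_system_def)
qed

theorem greedy_correct:
  assumes n: "1 \<le> n"
    and pos: "\<And>i k. i \<in> {1..n} \<Longrightarrow> k \<in> {1..N i} \<Longrightarrow> 0 < d i k"
    and sum: "\<And>i. i \<in> {1..n} \<Longrightarrow> (\<Sum>k=1..N i. d i k) = 1"
  shows "\<exists>w t. greedy n (offset n N) d = Some (w, t) \<and> solves_system n N d w \<and>
    t \<le> 9 * n * (\<Sum>i=1..n. N i) + 1"
proof -
  have guard: "fst (greedy_guard st) \<longleftrightarrow> total st < 1" "snd (greedy_guard st) = 1" for st
    by (simp_all add: greedy_guard_def less_op_def)
  have "\<exists>st t. while_timed greedy_guard (greedy_step n (offset n N)) (greedy_init d) = Some (st, t)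
      \<and> greedy_invariant n N d st \<and> \<not> fst (greedy_guard st)
      \<and> t \<le> 9 * n * unexhausted n N (greedy_init d) + 1"
  proof (rule while_timed_potential)
    show "greedy_invariant n N d (greedy_init d)"
      using pos sum by (rule greedy_invariant_init)
  qed (use greedy_invariant_step[OF n] greedy_step_cost[OF n] guard in auto)
  moreover have "unexhausted n N (greedy_init d) = (\<Sum>i=1..n. N i)"
    by (simp add: unexhausted_def greedy_init_def)
  ultimately show ?thesis
    by (auto simp: greedy_def guard not_less intro: greedy_invariant_final)
qed


section \<open>The running time for discrete probability measures\<close>

theorem theorem2:
  shows "\<exists>C::real. \<forall>(dim::nat) (n::nat) (P :: nat \<Rightarrow> (nat \<Rightarrow> real) pmf)
      (x :: nat \<Rightarrow> nat \<Rightarrow> (nat \<Rightarrow> real)) (N :: nat \<Rightarrow> nat) (d :: nat \<Rightarrow> nat \<Rightarrow> real).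
    1 \<le> n \<longrightarrow>
    (\<forall>i\<in>{1..n}. set_pmf (P i) \<subseteq> ({..<dim} \<rightarrow>\<^sub>E UNIV) \<and> finite (set_pmf (P i)) \<and>
       N i = card (set_pmf (P i)) \<and>
       bij_betw (x i) {1..N i} (set_pmf (P i)) \<and>
       (\<forall>j\<in>{1..N i}. d i j = pmf (P i) (x i j))) \<longrightarrow>
    (\<exists>w t. greedy n (offset n N) d = Some (w, t) \<and>
       solves_system n N d w \<and>
       real t \<le> C * real (n * (\<Sum>i=1..n. N i)))"
proof (intro exI[of _ "10::real"] allI impI, goal_cases)
  case (1 dim n P x N d)
  have bij: "bij_betw (x i) {1..N i} (set_pmf (P i))" and fin: "finite (set_pmf (P i))"
    and d: "\<And>j. j \<in> {1..N i} \<Longrightarrow> d i j = pmf (P i) (x i j)" if "i \<in> {1..n}" for i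
    using 1(2) that by blast+
  have pos: "0 < d i k" if "i \<in> {1..n}" "k \<in> {1..N i}" for i k
    using bij_betwE[OF bij] d that by (simp add: pmf_positive)
  have sum: "(\<Sum>k=1..N i. d i k) = 1" if i: "i \<in> {1..n}" for i
  proof -
    have "(\<Sum>k=1..N i. d i k) = (\<Sum>y\<in>set_pmf (P i). pmf (P i) y)"
      using d[OF i] sum.reindex_bij_betw[OF bij[OF i], of "pmf (P i)"] by simp
    also have "\<dots> = 1"
      using fin[OF i] by (intro sum_pmf_eq_1) auto
    finally show ?thesis .
  qed
  obtain w t where wt: "greedy n (offset n N) d = Some (w, t)" "solves_system n N d w"
    and t: "t \<le> 9 * n * (\<Sum>i=1..n. N i) + 1"
    using greedy_correct[where N = N and d = d, OF 1(1) pos sum] by blast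
  \<comment> \<open>Supports are nonempty, so the single operation of the failing guard is absorbed.\<close>
  have "N 1 \<noteq> 0"
    using sum[of 1] 1(1) by (intro notI) simp
  then have "0 < (\<Sum>i=1..n. N i)"
    using 1(1) by (intro sum_pos2[of _ 1]) auto
  then have "1 \<le> n * (\<Sum>i=1..n. N i)"
    using 1(1) by (simp add: Suc_le_eq)
  with t have "t \<le> 10 * (n * (\<Sum>i=1..n. N i))"
    unfolding mult.assoc by linarith
  then have "real t \<le> 10 * real (n * (\<Sum>i=1..n. N i))"
    by (metis of_nat_le_iff of_nat_mult of_nat_numeral)
  then show ?case using wt by blast
qed

end
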